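(* Let $X\in C^4(B,\mathbb R^4)$ be a conformally parametrized immersion and let $\{N_1,N_2\}$ be a critical orthonormal normal section of $X$. Then $\{N_1,N_2\}$ minimizes the total torsion, i.e. $$\mathcal T_X(N_1,N_2)\le\mathcal T_X(\widetilde N_1,\widetilde N_2)$$ for all orthonormal normal sections $\{\widetilde N_1,\widetilde N_2\}$ of $X$. Moreover, if $\{\widetilde N_1,\widetilde N_2\}$ is obtained from $\{N_1,N_2\}$ by the rotation $$\widetilde N_1=\cos\varphi\,N_1+\sin\varphi\,N_2,\qquad \widetilde N_2=-\sin\varphi\,N_1+\cos\varphi\,N_2$$ with rotation angle $\varphi\in C^3(B,\mathbb R)$, then equality holds if and only if $\varphi$ is constant.
   Context: $B=\{(u,v)\in\mathbb R^2: u^2+v^2\le 1\}$ is the closed unit disc. A conformally parametrized immersion is a map $X\in C^4(B,\mathbb R^4)$ with $|X_u|^2=|X_v|^2=:W>0$ and $X_u\cdot X_v=0$ in $B$. An orthonormal normal section of $X$ is a pair $N_1,N_2\in C^3(B,\mathbb R^4)$ with $X_u\cdot N_\sigma=X_v\cdot N_\sigma=0$, $|N_1|=|N_2|=1$, $N_1\cdot N_2=0$ in $B$. Torsion coefficients: $T_{1,1}^2:=N_{1,u}\cdot N_2$, $T_{1,2}^2:=N_{1,v}\cdot N_2$ (subscripts $u,v$ denote partial derivatives). Total torsion: $\mathcal T_X(N_1,N_2):=2\iint_B\{(T_{1,1}^2)^2+(T_{1,2}^2)^2\}\,du\,dv$. The section $\{N_1,N_2\}$ is critical if for every $\chi\in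 C^3(B,\mathbb R)$ the function $t\mapsto\mathcal T_X(\cos(t\chi)N_1+\sin(t\chi)N_2,\,-\sin(t\chi)N_1+\cos(t\chi)N_2)$ has vanishing derivative at $t=0$. *)

theory Defs
  imports "HOL-Analysis.Analysis"
begin

definition disc :: "(real \<times> real) set" where
  "disc = {(u, v). u\<^sup>2 + v\<^sup>2 \<le> 1}"

text \<open>Derivatives at points of the closed disc are Frechet derivatives relative to the disc, so that
  they make sense on the boundary circle as well. (Difference quotients along the coordinate
  axes would not do: the line through \<open>(1, 0)\<close> in direction \<open>v\<close> meets the disc in one point only.)
  Relative derivatives are unique, see \<open>partial_eqI\<close> below.\<close>

definition partial_u :: "(real \<times> real \<Rightarrow> 'a::real_normed_vector) \<Rightarrow> real \<times> real \<Rightarrow> 'a" where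
  "partial_u f p = frechet_derivative f (at p within disc) (1, 0)"

definition partial_v :: "(real \<times> real \<Rightarrow> 'a::real_normed_vector) \<Rightarrow> real \<times> real \<Rightarrow> 'a" where
  "partial_v f p = frechet_derivative f (at p within disc) (0, 1)"

text \<open>\<open>C_disc k f\<close> says that \<open>f\<close> restricted to the disc is of class \<open>C\<^sup>k\<close>. As the disc is convex with
  nonempty interior, this is the same as being \<open>C\<^sup>k\<close> in the interior with all partial derivatives
  up to order \<open>k\<close> extending continuously to the closed disc. Values outside the disc play no role.\<close>

primrec C_disc :: "nat \<Rightarrow> (real \<times> real \<Rightarrow> 'a::real_normed_vector) \<Rightarrow> bool" where
  "C_disc 0 f \<longleftrightarrow> continuous_on disc f"
| "C_disc (Suc k) f \<longleftrightarrow>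
     f differentiable_on disc \<and> C_disc k (partial_u f) \<and> C_disc k (partial_v f)"

definition conformal_immersion :: "(real \<times> real \<Rightarrow> real ^ 4) \<Rightarrow> bool" where
  "conformal_immersion X \<longleftrightarrow> C_disc 4 X \<and>
     (\<forall>p\<in>disc. (norm (partial_u X p))\<^sup>2 = (norm (partial_v X p))\<^sup>2 \<and>
        (norm (partial_u X p))\<^sup>2 > 0 \<and> partial_u X p \<bullet> partial_v X p = 0)"

definition orthonormal_normal_section ::
  "(real \<times> real \<Rightarrow> real ^ 4) \<Rightarrow> (real \<times> real \<Rightarrow> real ^ 4) \<Rightarrow> (real \<times> real \<Rightarrow> real ^ 4) \<Rightarrow> bool" where
  "orthonormal_normal_section X N1 N2 \<longleftrightarrow> C_disc 3 N1 \<and> C_disc 3 N2 \<and>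
     (\<forall>p\<in>disc. partial_u X p \<bullet> N1 p = 0 \<and> partial_v X p \<bullet> N1 p = 0 \<and>
        partial_u X p \<bullet> N2 p = 0 \<and> partial_v X p \<bullet> N2 p = 0 \<and>
        norm (N1 p) = 1 \<and> norm (N2 p) = 1 \<and> N1 p \<bullet> N2 p = 0)"

definition torsion_u ::
  "(real \<times> real \<Rightarrow> real ^ 4) \<Rightarrow> (real \<times> real \<Rightarrow> real ^ 4) \<Rightarrow> real \<times> real \<Rightarrow> real" where
  "torsion_u N1 N2 p = partial_u N1 p \<bullet> N2 p"

definition torsion_v ::
  "(real \<times> real \<Rightarrow> real ^ 4) \<Rightarrow> (real \<times> real \<Rightarrow> real ^ 4) \<Rightarrow> real \<times> real \<Rightarrow> real" where
  "torsion_v N1 N2 p = partial_v N1 p \<bullet> N2 p"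

definition total_torsion ::
  "(real \<times> real \<Rightarrow> real ^ 4) \<Rightarrow> (real \<times> real \<Rightarrow> real ^ 4) \<Rightarrow> real" where
  "total_torsion N1 N2 =
     2 * integral disc (\<lambda>p. (torsion_u N1 N2 p)\<^sup>2 + (torsion_v N1 N2 p)\<^sup>2)"

definition critical_section ::
  "(real \<times> real \<Rightarrow> real ^ 4) \<Rightarrow> (real \<times> real \<Rightarrow> real ^ 4) \<Rightarrow> bool" where
  "critical_section N1 N2 \<longleftrightarrow>
     (\<forall>\<psi>. C_disc 3 \<psi> \<longrightarrow>
        ((\<lambda>t. total_torsion
                (\<lambda>p. cos (t * \<psi> p) *\<^sub>R N1 p + sin (t * \<psi> p) *\<^sub>R N2 p)
                (\<lambda>p. - sin (t * \<psi> p) *\<^sub>R N1 p + cos (t * \<psi> p) *\<^sub>R N2 p))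
          has_real_derivative 0) (at 0))"

lemma has_derivative_within_disc_unique:
  fixes f :: "real \<times> real \<Rightarrow> 'a::real_normed_vector"
  assumes F: "(f has_derivative F) (at p within disc)"
    and G: "(f has_derivative G) (at p within disc)"
    and p: "p \<in> disc"
  shows "F = G"
proof -
  have disc_eq: "disc = cball 0 1"
    by (auto simp: disc_def cball_def dist_norm norm_Pair)
  define L where "L = (\<lambda>x. F x - G x)"
  have L: "((\<lambda>x. 0) has_derivative L) (at p within disc)"
    using has_derivative_diff[OF F G] by (simp add: L_def)
  interpret L: bounded_linear L
    using L by (rule has_derivative_bounded_linear)
  have dir: "L (y - p) = 0" if y: "y \<in> disc" for y
  proof -
    define c where "c = (\<lambda>t::real. p + t *\<^sub>R (y - p))"
    have c: "(c has_vector_derivative (y - p)) (at 0 within {0..1})"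
      unfolding c_def by (auto intro!: derivative_eq_intros)
    have sub: "c ` {0..1} \<subseteq> disc"
    proof (rule image_subsetI)
      fix t :: real assume t: "t \<in> {0..1}"
      have "c t = (1 - t) *\<^sub>R p + t *\<^sub>R y" by (simp add: c_def algebra_simps)
      then show "c t \<in> disc"
        using t p y convexD_alt[OF convex_cball, of p 0 1 y t] by (simp add: disc_eq)
    qed
    have "((\<lambda>x. 0) has_derivative L) (at (c 0) within c ` {0..1})"
      using has_derivative_subset[OF L sub] by (simp add: c_def)
    from vector_derivative_diff_chain_within[OF c this]
    have "((\<lambda>t. 0) has_vector_derivative L (y - p)) (at 0 within {0..1})"
      by (simp add: o_def)
    moreover have "((\<lambda>t. 0) has_vector_derivative 0) (at 0 within {0..1::real})"
      by simp
    ultimately show ?thesis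
      by (rule vector_derivative_unique_within[rotated]) (simp add: at_within_Icc_at_right)
  qed
  have p0: "L p = 0"
    using dir[of 0] by (simp add: L.diff disc_eq L.zero L.neg)
  have "L x = 0" for x
  proof (cases "x = 0")
    case False
    have "L (x /\<^sub>R norm x) = 0"
      using dir[of "x /\<^sub>R norm x"] False by (simp add: L.diff disc_eq p0)
    then show ?thesis using False by (simp add: L.scaleR)
  qed (simp add: L.zero)
  then show ?thesis by (auto simp: L_def)
qed

lemma partial_eqI:
  assumes "(f has_derivative F) (at p within disc)" "p \<in> disc"
  shows "partial_u f p = F (1, 0)" "partial_v f p = F (0, 1)"
proof -
  have "frechet_derivative f (at p within disc) = F"
    using assms has_derivative_within_disc_unique frechet_derivative_works
      differentiableI by metis
  then show "partial_u f p = F (1, 0)" "partial_v f p = F (0, 1)"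
    by (simp_all add: partial_u_def partial_v_def)
qed

end

(* Rotating an orthonormal frame by the angle \<phi> adds grad \<phi> to the torsion vector T, so the total
   torsion becomes T(N) + 4 \<integral> T \<bullet> grad \<phi> + 2 \<integral> |grad \<phi>|^2. Criticality says exactly that the linear
   term vanishes for all \<phi> (no integration by parts is needed). Any other section arises, up to the
   sign of its second vector, from a rotation, whose angle can be lifted to a continuous function
   on the simply connected disc and is then automatically of class C^3. *)

theory Submission
  imports Defs
begin

section \<open>Calculus of C^k functions on the closed disc\<close>

lemma disc_eq_cball: "disc = cball 0 1"
  by (auto simp: disc_def cball_def dist_norm norm_Pair)

text \<open>Linearity expands the derivative in the coordinate basis. This feeds partial derivatives
  into the usual rules for \<open>has_derivative\<close>, and \<open>partial_eqI\<close> reads the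
  new partials off the result.\<close>

lemma has_derivative_partials:
  assumes "f differentiable (at p within disc)"
  shows "(f has_derivative (\<lambda>h. fst h *\<^sub>R partial_u f p + snd h *\<^sub>R partial_v f p)) (at p within disc)"
proof -
  define F where "F = frechet_derivative f (at p within disc)"
  have F: "(f has_derivative F) (at p within disc)"
    using assms by (simp add: F_def frechet_derivative_works)
  then interpret bounded_linear F by (rule has_derivative_bounded_linear)
  have "F h = fst h *\<^sub>R partial_u f p + snd h *\<^sub>R partial_v f p" for h
  proof -
    have "h = fst h *\<^sub>R (1, 0) + snd h *\<^sub>R (0, 1)" by (simp add: prod_eq_iff)
    then have "F h = F (fst h *\<^sub>R (1, 0) + snd h *\<^sub>R (0, 1))" by simp
    also have "\<dots> = fst h *\<^sub>R F (1, 0) + snd h *\<^sub>R F (0, 1)" by (simp only: add scaleR)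
    finally show ?thesis by (simp add: F_def partial_u_def partial_v_def)
  qed
  then have "F = (\<lambda>h. fst h *\<^sub>R partial_u f p + snd h *\<^sub>R partial_v f p)" by blast
  with F show ?thesis by simp
qed

lemma differentiable_on_cong:
  assumes "f differentiable_on S" "\<And>p. p \<in> S \<Longrightarrow> f p = g p"
  shows "g differentiable_on S"
  using assms unfolding differentiable_on_def differentiable_def
  by (metis has_derivative_transform)

lemma partial_cong:
  assumes "f differentiable_on disc" "\<And>p. p \<in> disc \<Longrightarrow> f p = g p" "p \<in> disc"
  shows "partial_u g p = partial_u f p" "partial_v g p = partial_v f p"
proof -
  have "(g has_derivative (\<lambda>h. fst h *\<^sub>R partial_u f p + snd h *\<^sub>R partial_v f p)) (at p within disc)"
    using assms
    by (intro has_derivative_transform[where f = f and g = g] has_derivative_partials)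
      (auto simp: differentiable_on_def)
  from partial_eqI[OF this \<open>p \<in> disc\<close>]
  show "partial_u g p = partial_u f p" "partial_v g p = partial_v f p" by simp_all
qed

text \<open>Formulas for partial derivatives are available only on the disc, so the inductions on
  \<open>k\<close> below must be able to exchange functions that agree there.\<close>

lemma C_disc_cong:
  "C_disc k f \<Longrightarrow> (\<And>p. p \<in> disc \<Longrightarrow> f p = g p) \<Longrightarrow> C_disc k g"
proof (induction k arbitrary: f g)
  case 0
  then show ?case by (metis C_disc.simps(1) continuous_on_cong)
next
  case (Suc k)
  have f: "f differentiable_on disc" "C_disc k (partial_u f)" "C_disc k (partial_v f)"
    using Suc.prems(1) by auto
  note eq = partial_cong[OF f(1) Suc.prems(2), symmetric]
  have "C_disc k (partial_u g)" "C_disc k (partial_v g)"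
    using Suc.IH[OF f(2)] Suc.IH[OF f(3)] eq by blast+
  with differentiable_on_cong[OF f(1) Suc.prems(2)] show ?case by simp
qed

lemma C_disc_Suc_imp: "C_disc (Suc k) f \<Longrightarrow> C_disc k f"
proof (induction k arbitrary: f)
  case 0
  then show ?case by (auto intro: differentiable_imp_continuous_on)
next
  case (Suc k)
  then show ?case by (meson C_disc.simps(2))
qed

lemma C_disc_add: "C_disc k f \<Longrightarrow> C_disc k g \<Longrightarrow> C_disc k (\<lambda>p. f p + g p)"
proof (induction k arbitrary: f g)
  case 0
  then show ?case by (auto intro: continuous_on_add)
next
  case (Suc k)
  let ?s = "\<lambda>p. f p + g p"
  have d: "f differentiable_on disc" "g differentiable_on disc" using Suc.prems by auto
  have eq: "partial_u f p + partial_u g p = partial_u ?s p"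
    "partial_v f p + partial_v g p = partial_v ?s p" if "p \<in> disc" for p
    using partial_eqI[OF has_derivative_add[OF has_derivative_partials has_derivative_partials] that,
        of f g] d that
    by (simp_all add: differentiable_on_def)
  have "C_disc k (partial_u ?s)" "C_disc k (partial_v ?s)"
    using Suc.prems eq
    by (auto intro: C_disc_cong[OF Suc.IH[of "partial_u f" "partial_u g"]]
        C_disc_cong[OF Suc.IH[of "partial_v f" "partial_v g"]])
  with d show ?case by (auto simp: differentiable_on_def intro: differentiable_add)
qed

text \<open>By the Leibniz rule each partial is a sum of two products of class C^k; the
  undifferentiated factor gives up one order through \<open>C_disc_Suc_imp\<close>. The bilinear
  form covers inner products and real products at once.\<close>

lemma C_disc_bilinear:
  assumes "bounded_bilinear mul"
  shows "C_disc k f \<Longrightarrow> C_disc k g \<Longrightarrow> C_disc k (\<lambda>p. mul (f p) (g p))"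
proof (induction k arbitrary: f g)
  case 0
  then show ?case by (auto intro: bounded_bilinear.continuous_on[OF assms])
next
  case (Suc k)
  interpret bounded_bilinear mul by fact
  let ?m = "\<lambda>p. mul (f p) (g p)"
  have d: "f differentiable_on disc" "g differentiable_on disc" using Suc.prems by auto
  have D: "(?m has_derivative (\<lambda>h. mul (f p) (fst h *\<^sub>R partial_u g p + snd h *\<^sub>R partial_v g p) +
      mul (fst h *\<^sub>R partial_u f p + snd h *\<^sub>R partial_v f p) (g p))) (at p within disc)"
    if "p \<in> disc" for p
    using d that by (intro FDERIV has_derivative_partials) (auto simp: differentiable_on_def)
  have C: "C_disc k f" "C_disc k g" "C_disc k (partial_u f)" "C_disc k (partial_u g)"
    "C_disc k (partial_v f)" "C_disc k (partial_v g)"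
    using Suc.prems C_disc_Suc_imp by auto
  have "C_disc k (partial_u ?m)"
    by (rule C_disc_cong[OF C_disc_add[OF Suc.IH[OF C(1,4)] Suc.IH[OF C(3,2)]]])
      (simp add: partial_eqI[OF D])
  moreover have "C_disc k (partial_v ?m)"
    by (rule C_disc_cong[OF C_disc_add[OF Suc.IH[OF C(1,6)] Suc.IH[OF C(5,2)]]])
      (simp add: partial_eqI[OF D])
  moreover have "?m differentiable_on disc"
    using D by (auto simp: differentiable_on_def differentiable_def)
  ultimately show ?case by simp
qed

lemmas C_disc_inner = C_disc_bilinear[OF bounded_bilinear_inner]
lemmas C_disc_mult = C_disc_bilinear[OF bounded_bilinear_mult]

lemma partial_cmult:
  fixes \<phi> :: "real \<times> real \<Rightarrow> real"
  assumes "\<phi> differentiable_on disc" "p \<in> disc"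
  shows "partial_u (\<lambda>p. c * \<phi> p) p = c * partial_u \<phi> p"
    "partial_v (\<lambda>p. c * \<phi> p) p = c * partial_v \<phi> p"
proof -
  have D: "((\<lambda>p. c * \<phi> p) has_derivative
      (\<lambda>h. c * (fst h *\<^sub>R partial_u \<phi> p + snd h *\<^sub>R partial_v \<phi> p))) (at p within disc)"
    using assms
    by (intro has_derivative_mult_right has_derivative_partials) (auto simp: differentiable_on_def)
  show "partial_u (\<lambda>p. c * \<phi> p) p = c * partial_u \<phi> p"
    "partial_v (\<lambda>p. c * \<phi> p) p = c * partial_v \<phi> p"
    using partial_eqI[OF D \<open>p \<in> disc\<close>] by simp_all
qed

lemma C_disc_cmult:
  fixes f :: "real \<times> real \<Rightarrow> real"
  shows "C_disc k f \<Longrightarrow> C_disc k (\<lambda>p. c * f p)"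
proof (induction k arbitrary: f)
  case 0
  then show ?case by (auto intro: continuous_intros)
next
  case (Suc k)
  have d: "f differentiable_on disc" using Suc.prems by auto
  have "C_disc k (partial_u (\<lambda>p. c * f p))"
    by (rule C_disc_cong[OF Suc.IH[of "partial_u f"]]) (use Suc.prems in \<open>auto simp: partial_cmult[OF d]\<close>)
  moreover have "C_disc k (partial_v (\<lambda>p. c * f p))"
    by (rule C_disc_cong[OF Suc.IH[of "partial_v f"]]) (use Suc.prems in \<open>auto simp: partial_cmult[OF d]\<close>)
  moreover have "(\<lambda>p. c * f p) differentiable_on disc"
    using d by (auto simp: differentiable_on_def intro: differentiable_mult)
  ultimately show ?case by simp
qed

section \<open>Integrals of continuous functions over the disc\<close>

lemma integrable_on_disc:
  fixes f :: "real \<times> real \<Rightarrow> real"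
  assumes "continuous_on disc f"
  shows "f integrable_on disc"
proof -
  have "set_integrable lborel disc f"
    unfolding set_integrable_def
    using borel_integrable_compact[of disc f] assms by (simp add: disc_eq_cball mult.commute)
  then show ?thesis by (rule set_borel_integral_eq_integral(1))
qed

text \<open>The bounding circle is a null set, so \<open>f\<close> vanishes on the open ball, and by
  continuity on its closure, which is the disc.\<close>

lemma continuous_integral_0_disc:
  fixes f :: "real \<times> real \<Rightarrow> real"
  assumes f: "continuous_on disc f" and nn: "\<And>p. p \<in> disc \<Longrightarrow> 0 \<le> f p"
    and 0: "integral disc f = 0" and p: "p \<in> disc"
  shows "f p = 0"
proof -
  have cl: "closure (ball 0 1 :: (real \<times> real) set) = disc" by (simp add: disc_eq_cball)
  have "(f has_integral 0) disc"
    using integrable_on_disc[OF f] 0 by (simp add: has_integral_iff)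
  moreover have "emeasure lborel (cball (0 :: real \<times> real) 1) = emeasure lborel (ball (0 :: real \<times> real) 1)"
    by (simp add: emeasure_cball emeasure_ball)
  moreover have "emeasure lborel (ball (0 :: real \<times> real) 1) > 0"
    by (simp add: emeasure_ball unit_ball_vol_pos)
  moreover have "emeasure lborel (ball (0 :: real \<times> real) 1) < \<infinity>"
    by (simp add: emeasure_ball)
  ultimately show ?thesis
    using has_integral_0_closure_imp_0[of "ball 0 1" f p] assms unfolding cl
    by (auto simp: disc_eq_cball)
qed

subsection \<open>Rotating a frame\<close>

locale disc_frame =
  fixes N1 N2 :: "real \<times> real \<Rightarrow> real ^ 4"
  assumes smooth: "C_disc 3 N1" "C_disc 3 N2"
    and orthonormal: "\<And>p. p \<in> disc \<Longrightarrow> norm (N1 p) = 1" "\<And>p. p \<in> disc \<Longrightarrow> norm (N2 p) = 1"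
      "\<And>p. p \<in> disc \<Longrightarrow> N1 p \<bullet> N2 p = 0"
begin

lemma differentiable: "N1 differentiable_on disc" "N2 differentiable_on disc"
  using smooth by (simp_all add: numeral_3_eq_3)

lemma inner_N:
  assumes "p \<in> disc"
  shows "N1 p \<bullet> N1 p = 1" "N2 p \<bullet> N2 p = 1" "N1 p \<bullet> N2 p = 0" "N2 p \<bullet> N1 p = 0"
  using orthonormal[OF assms] by (simp_all add: dot_square_norm inner_commute)

text \<open>Differentiating the orthonormality relations makes the matrix of products of frame
  derivatives with frame vectors skew. Only \<open>D1 h \<bullet> N2 p\<close> survives, and cos^2 +
  sin^2 = 1 removes the angle except for its derivative.\<close>

lemma torsion_rotate:
  fixes \<phi> :: "real \<times> real \<Rightarrow> real"
  assumes \<phi>: "\<phi> differentiable_on disc"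
    and M1: "\<And>p. p \<in> disc \<Longrightarrow> M1 p = cos (\<phi> p) *\<^sub>R N1 p + sin (\<phi> p) *\<^sub>R N2 p"
    and M2: "\<And>p. p \<in> disc \<Longrightarrow> M2 p = - sin (\<phi> p) *\<^sub>R N1 p + cos (\<phi> p) *\<^sub>R N2 p"
    and p: "p \<in> disc"
  shows "torsion_u M1 M2 p = torsion_u N1 N2 p + partial_u \<phi> p"
    and "torsion_v M1 M2 p = torsion_v N1 N2 p + partial_v \<phi> p"
proof -
  define D1 where "D1 = (\<lambda>h. fst h *\<^sub>R partial_u N1 p + snd h *\<^sub>R partial_v N1 p)"
  define D2 where "D2 = (\<lambda>h. fst h *\<^sub>R partial_u N2 p + snd h *\<^sub>R partial_v N2 p)"
  define P where "P = (\<lambda>h. fst h *\<^sub>R partial_u \<phi> p + snd h *\<^sub>R partial_v \<phi> p)"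
  have D1: "(N1 has_derivative D1) (at p within disc)"
    and D2: "(N2 has_derivative D2) (at p within disc)"
    and P: "(\<phi> has_derivative P) (at p within disc)"
    unfolding D1_def D2_def P_def
    by (rule has_derivative_partials, use differentiable \<phi> p in \<open>simp add: differentiable_on_def\<close>)+
  \<comment> \<open>Uniqueness of relative derivatives makes every derivative of a function constant
    on the disc vanish, also at boundary points. It is applied to the three inner products of the
    frame.\<close>
  have const: "L = (\<lambda>h. 0)"
    if "(f has_derivative L) (at p within disc)" "\<And>q. q \<in> disc \<Longrightarrow> f q = c"
    for f :: "real \<times> real \<Rightarrow> real" and L c
  proof (rule has_derivative_within_disc_unique[OF that(1) _ p])
    show "(f has_derivative (\<lambda>h. 0)) (at p within disc)"
      by (rule has_derivative_transform[OF p that(2) has_derivative_const])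
  qed
  have 11: "D1 h \<bullet> N1 p = 0" for h
    using fun_cong[OF const[OF has_derivative_inner[OF D1 D1] inner_N(1)], of h]
    by (simp add: inner_commute)
  have 22: "D2 h \<bullet> N2 p = 0" for h
    using fun_cong[OF const[OF has_derivative_inner[OF D2 D2] inner_N(2)], of h]
    by (simp add: inner_commute)
  have 12: "D2 h \<bullet> N1 p = - (D1 h \<bullet> N2 p)" for h
    using fun_cong[OF const[OF has_derivative_inner[OF D1 D2] inner_N(3)], of h]
    by (simp add: inner_commute)
  define F where "F = (\<lambda>h. (cos (\<phi> p) *\<^sub>R D1 h - (P h * sin (\<phi> p)) *\<^sub>R N1 p) +
       (sin (\<phi> p) *\<^sub>R D2 h + (P h * cos (\<phi> p)) *\<^sub>R N2 p))"
  have "((\<lambda>p. cos (\<phi> p) *\<^sub>R N1 p + sin (\<phi> p) *\<^sub>R N2 p) has_derivative F) (at p within disc)"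
    unfolding F_def by (auto intro!: derivative_eq_intros D1 D2 P)
  then have F: "(M1 has_derivative F) (at p within disc)"
    by (rule has_derivative_transform[OF p M1, rotated])
  have "F h \<bullet> M2 p = D1 h \<bullet> N2 p + P h" for h
  proof -
    have "F h \<bullet> M2 p = (sin (\<phi> p) * sin (\<phi> p) + cos (\<phi> p) * cos (\<phi> p)) * (D1 h \<bullet> N2 p + P h)"
      unfolding M2[OF p] F_def
      by (simp only: inner_add_left inner_add_right inner_diff_left inner_scaleR_left
          inner_scaleR_right inner_N[OF p] 11 22 12) algebra
    then show ?thesis by (simp flip: power2_eq_square)
  qed
  then show "torsion_u M1 M2 p = torsion_u N1 N2 p + partial_u \<phi> p"
    and "torsion_v M1 M2 p = torsion_v N1 N2 p + partial_v \<phi> p"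
    unfolding torsion_u_def torsion_v_def partial_eqI[OF F p] by (simp_all add: D1_def P_def)
qed

lemma continuous_torsion:
  "continuous_on disc (torsion_u N1 N2)" "continuous_on disc (torsion_v N1 N2)"
proof -
  have "continuous_on disc (partial_u N1)" "continuous_on disc (partial_v N1)"
    using smooth by (auto simp: numeral_3_eq_3 dest: differentiable_imp_continuous_on)
  then show "continuous_on disc (torsion_u N1 N2)" "continuous_on disc (torsion_v N1 N2)"
    unfolding torsion_u_def torsion_v_def
    using differentiable_imp_continuous_on[OF differentiable(2)]
    by (auto intro!: continuous_on_inner)
qed

text \<open>Up to the factor 4 this is the first variation of the total torsion in the direction
  \<open>\<phi>\<close>.\<close>

definition torsion_pairing :: "(real \<times> real \<Rightarrow> real) \<Rightarrow> real" where
  "torsion_pairing \<phi> = integral disc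
     (\<lambda>p. torsion_u N1 N2 p * partial_u \<phi> p + torsion_v N1 N2 p * partial_v \<phi> p)"

definition dirichlet :: "(real \<times> real \<Rightarrow> real) \<Rightarrow> real" where
  "dirichlet \<phi> = integral disc (\<lambda>p. (partial_u \<phi> p)\<^sup>2 + (partial_v \<phi> p)\<^sup>2)"

lemma total_torsion_rotate:
  fixes \<phi> :: "real \<times> real \<Rightarrow> real"
  assumes \<phi>: "C_disc 3 \<phi>"
    and M1: "\<And>p. p \<in> disc \<Longrightarrow> M1 p = cos (\<phi> p) *\<^sub>R N1 p + sin (\<phi> p) *\<^sub>R N2 p"
    and M2: "\<And>p. p \<in> disc \<Longrightarrow> M2 p = - sin (\<phi> p) *\<^sub>R N1 p + cos (\<phi> p) *\<^sub>R N2 p"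
  shows "total_torsion M1 M2 = total_torsion N1 N2 + 4 * torsion_pairing \<phi> + 2 * dirichlet \<phi>"
proof -
  have d: "\<phi> differentiable_on disc" using \<phi> by (simp add: numeral_3_eq_3)
  have c: "continuous_on disc (partial_u \<phi>)" "continuous_on disc (partial_v \<phi>)"
    using \<phi> by (auto simp: numeral_3_eq_3 dest: differentiable_imp_continuous_on)
  let ?A = "\<lambda>p. (torsion_u N1 N2 p)\<^sup>2 + (torsion_v N1 N2 p)\<^sup>2"
  let ?B = "\<lambda>p. torsion_u N1 N2 p * partial_u \<phi> p + torsion_v N1 N2 p * partial_v \<phi> p"
  let ?C = "\<lambda>p. (partial_u \<phi> p)\<^sup>2 + (partial_v \<phi> p)\<^sup>2"
  have i: "?A integrable_on disc" "?B integrable_on disc" "?C integrable_on disc"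
    by (intro integrable_on_disc continuous_intros continuous_torsion c)+
  have "integral disc (\<lambda>p. (torsion_u M1 M2 p)\<^sup>2 + (torsion_v M1 M2 p)\<^sup>2)
      = integral disc (\<lambda>p. (?A p + 2 * ?B p) + ?C p)"
    by (rule integral_cong)
      (simp add: torsion_rotate[OF d M1 M2] power2_eq_square algebra_simps)
  also have "\<dots> = integral disc ?A + 2 * integral disc ?B + integral disc ?C"
    using i by (simp only: integral_add integrable_add integrable_on_mult_right integral_mult_right)
  finally show ?thesis
    by (simp add: total_torsion_def torsion_pairing_def dirichlet_def)
qed

text \<open>For the angle \<open>t * \<phi>\<close> the pairing scales with \<open>t\<close> and the
  Dirichlet term with t^2. The total torsion is thus a quadratic polynomial in \<open>t\<close>,
  whose derivative at 0 is four times the pairing.\<close>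

lemma critical_imp_torsion_pairing_eq_0:
  assumes crit: "critical_section N1 N2" and \<phi>: "C_disc 3 \<phi>"
  shows "torsion_pairing \<phi> = 0"
proof -
  have d: "\<phi> differentiable_on disc" using \<phi> by (simp add: numeral_3_eq_3)
  have "torsion_pairing (\<lambda>p. t * \<phi> p) = t * torsion_pairing \<phi>" for t
    unfolding torsion_pairing_def integral_mult_right[symmetric]
    by (rule integral_cong) (simp add: partial_cmult[OF d] algebra_simps)
  moreover have "dirichlet (\<lambda>p. t * \<phi> p) = t\<^sup>2 * dirichlet \<phi>" for t
    unfolding dirichlet_def integral_mult_right[symmetric]
    by (rule integral_cong) (simp add: partial_cmult[OF d] power2_eq_square algebra_simps)
  ultimately have *: "total_torsion
      (\<lambda>p. cos (t * \<phi> p) *\<^sub>R N1 p + sin (t * \<phi> p) *\<^sub>R N2 p)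
      (\<lambda>p. - sin (t * \<phi> p) *\<^sub>R N1 p + cos (t * \<phi> p) *\<^sub>R N2 p)
      = total_torsion N1 N2 + 4 * (t * torsion_pairing \<phi>) + 2 * (t\<^sup>2 * dirichlet \<phi>)" for t
    using total_torsion_rotate[OF C_disc_cmult[OF \<phi>, of t]] by simp
  have "((\<lambda>t. total_torsion N1 N2 + 4 * (t * torsion_pairing \<phi>) + 2 * (t\<^sup>2 * dirichlet \<phi>))
      has_real_derivative 4 * torsion_pairing \<phi>) (at 0)"
    by (auto intro!: derivative_eq_intros)
  moreover have "((\<lambda>t. total_torsion N1 N2 + 4 * (t * torsion_pairing \<phi>) + 2 * (t\<^sup>2 * dirichlet \<phi>))
      has_real_derivative 0) (at 0)"
    unfolding *[symmetric] using crit \<phi> by (simp only: critical_section_def)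
  ultimately show ?thesis using DERIV_unique by fastforce
qed

lemma dirichlet_nonneg: "0 \<le> dirichlet \<phi>"
  unfolding dirichlet_def
  \<comment> \<open>The split covers arbitrary \<open>\<phi>\<close>: the integral of a
    non-integrable function is 0 by default.\<close>
  by (cases "(\<lambda>p. (partial_u \<phi> p)\<^sup>2 + (partial_v \<phi> p)\<^sup>2) integrable_on disc")
    (auto intro: integral_nonneg simp: not_integrable_integral)

text \<open>Zero energy forces the continuous gradient to vanish at every point, and on the convex
  disc a function with zero derivative is constant.\<close>

lemma dirichlet_eq_0_iff:
  assumes \<phi>: "C_disc 3 \<phi>"
  shows "dirichlet \<phi> = 0 \<longleftrightarrow> \<phi> constant_on disc"
proof
  have d: "\<phi> differentiable_on disc" using \<phi> by (simp add: numeral_3_eq_3)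
  have c: "continuous_on disc (partial_u \<phi>)" "continuous_on disc (partial_v \<phi>)"
    using \<phi> by (auto simp: numeral_3_eq_3 dest: differentiable_imp_continuous_on)
  assume "dirichlet \<phi> = 0"
  moreover have "continuous_on disc (\<lambda>p. (partial_u \<phi> p)\<^sup>2 + (partial_v \<phi> p)\<^sup>2)"
    by (intro continuous_intros c)
  ultimately have "(partial_u \<phi> p)\<^sup>2 + (partial_v \<phi> p)\<^sup>2 = 0" if "p \<in> disc" for p
    using continuous_integral_0_disc[of "\<lambda>p. (partial_u \<phi> p)\<^sup>2 + (partial_v \<phi> p)\<^sup>2" p] that
    by (simp add: dirichlet_def)
  then have 0: "partial_u \<phi> p = 0" "partial_v \<phi> p = 0" if "p \<in> disc" for p
    using that by (simp_all add: sum_power2_eq_zero_iff)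
  have "(\<phi> has_derivative (\<lambda>h. 0)) (at p within disc)" if "p \<in> disc" for p
    using has_derivative_partials[of \<phi> p] d that by (simp add: 0 differentiable_on_def)
  then show "\<phi> constant_on disc"
    using has_derivative_zero_constant[of disc \<phi>] by (auto simp: constant_on_def disc_eq_cball)
next
  assume "\<phi> constant_on disc"
  then obtain c where c: "\<And>p. p \<in> disc \<Longrightarrow> \<phi> p = c" by (auto simp: constant_on_def)
  have D: "(\<phi> has_derivative (\<lambda>h. 0)) (at p within disc)" if "p \<in> disc" for p
    by (rule has_derivative_transform[OF that c has_derivative_const])
  have "dirichlet \<phi> = integral disc (\<lambda>p. 0)"
    unfolding dirichlet_def by (rule integral_cong) (simp add: partial_eqI[OF D])
  then show "dirichlet \<phi> = 0" by simp
qed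

end

subsection \<open>Lifting the rotation angle\<close>

text \<open>The lift is at first only continuous. Its derivative turns out to be a db - b da, an
  expression of class C^k, so the angle gains the full regularity of \<open>a\<close> and
  \<open>b\<close>.\<close>

lemma C_disc_angle:
  fixes a b :: "real \<times> real \<Rightarrow> real"
  assumes a: "C_disc (Suc k) a" and b: "C_disc (Suc k) b"
    and unit: "\<And>p. p \<in> disc \<Longrightarrow> (a p)\<^sup>2 + (b p)\<^sup>2 = 1"
  obtains \<phi> where "C_disc (Suc k) \<phi>" "\<And>p. p \<in> disc \<Longrightarrow> a p = cos (\<phi> p)"
    "\<And>p. p \<in> disc \<Longrightarrow> b p = sin (\<phi> p)"
proof -
  have d: "a differentiable_on disc" "b differentiable_on disc" using a b by auto
  have c: "continuous_on disc a" "continuous_on disc b"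
    using d by (auto intro: differentiable_imp_continuous_on)
  \<comment> \<open>A nowhere vanishing continuous map on a contractible set has a continuous
    logarithm \<open>g\<close>. Modulus 1 makes its real part vanish, so its imaginary part is the
    angle.\<close>
  have "contractible disc" by (simp add: disc_eq_cball convex_imp_contractible)
  moreover have "continuous_on disc (\<lambda>p. Complex (a p) (b p))"
    unfolding Complex_eq by (intro continuous_intros c)
  moreover have "Complex (a p) (b p) \<noteq> 0" if "p \<in> disc" for p
    using unit[OF that] by (auto simp: complex_eq_iff)
  ultimately obtain g where g: "continuous_on disc g"
    "\<And>p. p \<in> disc \<Longrightarrow> Complex (a p) (b p) = exp (g p)"
    using continuous_logarithm_on_contractible[of disc "\<lambda>p. Complex (a p) (b p)"] by blast
  define \<phi> where "\<phi> = (\<lambda>p. Im (g p))"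
  have \<phi>: "continuous_on disc \<phi>" unfolding \<phi>_def by (intro continuous_intros g)
  have ab: "a p = cos (\<phi> p)" "b p = sin (\<phi> p)" if "p \<in> disc" for p
  proof -
    have "exp (Re (g p)) = norm (Complex (a p) (b p))" using g(2)[OF that] by simp
    also have "\<dots> = 1" using unit[OF that] by (simp add: complex_norm)
    finally have "exp (Re (g p)) = 1" .
    then show "a p = cos (\<phi> p)" "b p = sin (\<phi> p)"
      using g(2)[OF that] by (auto simp: \<phi>_def complex_eq_iff Re_exp Im_exp)
  qed
  \<comment> \<open>The formula is found by formally differentiating a = cos \<phi> and b = sin
    \<phi>; differentiability of the lift itself is what has to be proved.\<close>
  have D: "(\<phi> has_derivative (\<lambda>h. a p * (fst h *\<^sub>R partial_u b p + snd h *\<^sub>R partial_v b p) -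
      b p * (fst h *\<^sub>R partial_u a p + snd h *\<^sub>R partial_v a p))) (at p within disc)"
    (is "(_ has_derivative ?L) _")
    if p: "p \<in> disc" for p
  proof -
    \<comment> \<open>Continuity keeps angle differences below \<open>pi / 2\<close>, where
      \<open>arcsin\<close> inverts \<open>sin\<close>; this excludes jumps by multiples of 2
      pi.\<close>
    obtain e where e: "e > 0" "\<And>q. q \<in> disc \<Longrightarrow> dist q p < e \<Longrightarrow> dist (\<phi> q) (\<phi> p) < pi / 2"
      using \<phi> p unfolding continuous_on_iff by (metis pi_half_gt_zero)
    \<comment> \<open>Near \<open>p\<close> the lift is \<open>\<phi> p + arcsin (s q)\<close> with \<open>s q = sin (\<phi> q - \<phi> p)\<close>.\<close>
    define s where "s = (\<lambda>q. a p * b q - b p * a q)"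
    have s: "s q = sin (\<phi> q - \<phi> p)" if "q \<in> disc" for q
      using ab p that by (simp add: s_def sin_diff)
    have "(s has_derivative ?L) (at p within disc)"
      unfolding s_def using d p
      by (intro has_derivative_diff has_derivative_mult_right has_derivative_partials)
        (auto simp: differentiable_on_def)
    \<comment> \<open>Since \<open>s p\<close> is 0, \<open>arcsin\<close> is differentiated at 0,
      where its slope is 1.\<close>
    moreover have "(arcsin has_derivative (\<lambda>h. h)) (at (s p))"
      using DERIV_arcsin[of 0] by (simp add: s_def mult.commute has_field_derivative_def mult_1[abs_def])
    ultimately have "((\<lambda>q. arcsin (s q)) has_derivative ?L) (at p within disc)"
      by (rule has_derivative_compose)
    then have "((\<lambda>q. \<phi> p + arcsin (s q)) has_derivative ?L) (at p within disc)"
      using has_derivative_add[OF has_derivative_const[of "\<phi> p"]] by fastforce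
    then show ?thesis
    proof (rule has_derivative_transform_within[OF _ e(1) p])
      fix q assume q: "q \<in> disc" "dist q p < e"
      then have "\<bar>\<phi> q - \<phi> p\<bar> < pi / 2" using e(2) by (simp add: dist_real_def)
      then have "arcsin (s q) = \<phi> q - \<phi> p"
        unfolding s[OF q(1)] by (intro arcsin_sin; linarith)
      then show "\<phi> p + arcsin (s q) = \<phi> q" by simp
    qed
  qed
  have C: "C_disc k a" "C_disc k b" "C_disc k (partial_u a)" "C_disc k (partial_u b)"
    "C_disc k (partial_v a)" "C_disc k (partial_v b)"
    using a b C_disc_Suc_imp by auto
  have "C_disc k (\<lambda>p. a p * partial_u b p + - 1 * (b p * partial_u a p))"
    "C_disc k (\<lambda>p. a p * partial_v b p + - 1 * (b p * partial_v a p))"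
    by (intro C_disc_add C_disc_cmult C_disc_mult C)+
  from this(1)[THEN C_disc_cong, of "partial_u \<phi>"] this(2)[THEN C_disc_cong, of "partial_v \<phi>"]
  have "C_disc k (partial_u \<phi>)" "C_disc k (partial_v \<phi>)"
    by (simp_all add: partial_eqI[OF D])
  moreover have "\<phi> differentiable_on disc"
    using D by (auto simp: differentiable_on_def differentiable_def)
  ultimately have "C_disc (Suc k) \<phi>" by simp
  then show thesis using ab that by blast
qed

section \<open>Comparing two orthonormal frames of the normal plane\<close>

text \<open>Otherwise five nonzero, pairwise orthogonal vectors would be linearly independent in
  dimension four.\<close>

lemma orthogonal_four_imp_zero:
  fixes w :: "real ^ 4"
  assumes nz: "x \<noteq> 0" "y \<noteq> 0" "z \<noteq> 0" "t \<noteq> 0"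
    and o: "x \<bullet> y = 0" "x \<bullet> z = 0" "x \<bullet> t = 0" "y \<bullet> z = 0" "y \<bullet> t = 0" "z \<bullet> t = 0"
    and w: "x \<bullet> w = 0" "y \<bullet> w = 0" "z \<bullet> w = 0" "t \<bullet> w = 0"
  shows "w = 0"
proof (rule ccontr)
  assume "w \<noteq> 0"
  let ?S = "{x, y, z, t, w}"
  have "pairwise orthogonal ?S"
    using o w by (auto simp: pairwise_def orthogonal_def inner_commute)
  moreover have "0 \<notin> ?S" using nz \<open>w \<noteq> 0\<close> by auto
  ultimately have "card ?S \<le> DIM(real ^ 4)"
    using pairwise_orthogonal_independent independent_bound by blast
  \<comment> \<open>Two equal entries would make a nonzero vector orthogonal to itself; distinctness
    ensures that the set really has five elements.\<close>
  moreover have "distinct [x, y, z, t, w]"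
    using o w nz \<open>w \<noteq> 0\<close> by auto
  then have "card ?S = 5" using distinct_card by fastforce
  ultimately show False by simp
qed

text \<open>The remainder of \<open>w\<close> after projection to the span of \<open>N1 p\<close>
  and \<open>N2 p\<close> is orthogonal to both tangent and both normal vectors. Conformality makes
  these four an orthogonal family of nonzero vectors.\<close>

lemma normal_plane_expansion:
  fixes w :: "real ^ 4"
  assumes X: "conformal_immersion X" and N: "orthonormal_normal_section X N1 N2"
    and p: "p \<in> disc" and w: "partial_u X p \<bullet> w = 0" "partial_v X p \<bullet> w = 0"
  shows "w = (w \<bullet> N1 p) *\<^sub>R N1 p + (w \<bullet> N2 p) *\<^sub>R N2 p"
proof -
  have X': "partial_u X p \<noteq> 0" "partial_v X p \<noteq> 0" "partial_u X p \<bullet> partial_v X p = 0"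
    using X p unfolding conformal_immersion_def by fastforce+
  have N': "partial_u X p \<bullet> N1 p = 0" "partial_v X p \<bullet> N1 p = 0"
    "partial_u X p \<bullet> N2 p = 0" "partial_v X p \<bullet> N2 p = 0"
    "norm (N1 p) = 1" "norm (N2 p) = 1" "N1 p \<bullet> N2 p = 0"
    using N p unfolding orthonormal_normal_section_def by blast+
  have "w - ((w \<bullet> N1 p) *\<^sub>R N1 p + (w \<bullet> N2 p) *\<^sub>R N2 p) = 0"
    by (rule orthogonal_four_imp_zero[of "partial_u X p" "partial_v X p" "N1 p" "N2 p"])
      (use X' N' w in \<open>auto simp: inner_diff_right inner_add_right dot_square_norm inner_commute\<close>)
  then show ?thesis by simp
qed

text \<open>The rows (a, b) and (c, d) form an orthogonal matrix. Its determinant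
  \<open>\<epsilon>\<close> is 1 for a rotation and -1 for a reflection, and the second row is
  \<open>\<epsilon>\<close> times the first row turned by a right angle.\<close>

lemma unit_orthogonal_plane_cases:
  fixes a b c d :: real
  assumes "a\<^sup>2 + b\<^sup>2 = 1" "c\<^sup>2 + d\<^sup>2 = 1" "a * c + b * d = 0"
  shows "c = - b \<and> d = a \<or> c = b \<and> d = - a"
proof -
  define \<epsilon> where "\<epsilon> = a * d - b * c"
  \<comment> \<open>Here \<open>c\<close> is multiplied by a sum equal to 1 and a multiple of the
    vanishing inner product is subtracted, so that \<open>\<epsilon>\<close> factors out.\<close>
  have "c = c * (a\<^sup>2 + b\<^sup>2) - a * (a * c + b * d)" using assms by simp
  then have c: "c = - b * \<epsilon>" by (simp add: \<epsilon>_def algebra_simps power2_eq_square)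
  have "d = d * (a\<^sup>2 + b\<^sup>2) - b * (a * c + b * d)" using assms by simp
  then have d: "d = a * \<epsilon>" by (simp add: \<epsilon>_def algebra_simps power2_eq_square)
  have "c\<^sup>2 + d\<^sup>2 = (a\<^sup>2 + b\<^sup>2) * \<epsilon>\<^sup>2" by (simp add: c d algebra_simps power2_eq_square)
  then have "\<epsilon>\<^sup>2 = 1" using assms by simp
  then have "\<epsilon> = 1 \<or> \<epsilon> = - 1" by (simp add: power2_eq_1_iff)
  with c d show ?thesis by auto
qed

section \<open>Minimality of critical sections and the case of equality\<close>

theorem mainTheorem4:
  fixes X N1 N2 :: "real \<times> real \<Rightarrow> real ^ 4"
  assumes "conformal_immersion X"
    and "orthonormal_normal_section X N1 N2"
    and "critical_section N1 N2"
  shows "(\<forall>M1 M2. orthonormal_normal_section X M1 M2 \<longrightarrow>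
            total_torsion N1 N2 \<le> total_torsion M1 M2) \<and>
         (\<forall>\<phi> M1 M2. C_disc 3 \<phi> \<longrightarrow>
            (\<forall>p\<in>disc. M1 p = cos (\<phi> p) *\<^sub>R N1 p + sin (\<phi> p) *\<^sub>R N2 p \<and>
                      M2 p = - sin (\<phi> p) *\<^sub>R N1 p + cos (\<phi> p) *\<^sub>R N2 p) \<longrightarrow>
            (total_torsion N1 N2 = total_torsion M1 M2 \<longleftrightarrow> \<phi> constant_on disc))"
proof -
  interpret disc_frame N1 N2
    using assms(2) by unfold_locales (auto simp: orthonormal_normal_section_def)
  have tot: "total_torsion M1 M2 = total_torsion N1 N2 + 2 * dirichlet \<phi>"
    if "C_disc 3 \<phi>" "\<And>p. p \<in> disc \<Longrightarrow> M1 p = cos (\<phi> p) *\<^sub>R N1 p + sin (\<phi> p) *\<^sub>R N2 p"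
      "\<And>p. p \<in> disc \<Longrightarrow> M2 p = - sin (\<phi> p) *\<^sub>R N1 p + cos (\<phi> p) *\<^sub>R N2 p" for \<phi> M1 M2
    using total_torsion_rotate[OF that] critical_imp_torsion_pairing_eq_0[OF assms(3) that(1)] by simp
  have "total_torsion N1 N2 \<le> total_torsion M1 M2" if M: "orthonormal_normal_section X M1 M2" for M1 M2
  proof -
    have M': "partial_u X p \<bullet> M1 p = 0" "partial_v X p \<bullet> M1 p = 0"
      "partial_u X p \<bullet> M2 p = 0" "partial_v X p \<bullet> M2 p = 0"
      "M1 p \<bullet> M1 p = 1" "M2 p \<bullet> M2 p = 1" "M1 p \<bullet> M2 p = 0" if "p \<in> disc" for p
      using M that by (auto simp: orthonormal_normal_section_def dot_square_norm)
    \<comment> \<open>These are the entries of the pointwise orthogonal matrix that takes the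
      critical frame to the competing one.\<close>
    define a where "a = (\<lambda>p. M1 p \<bullet> N1 p)"
    define b where "b = (\<lambda>p. M1 p \<bullet> N2 p)"
    define c where "c = (\<lambda>p. M2 p \<bullet> N1 p)"
    define d where "d = (\<lambda>p. M2 p \<bullet> N2 p)"
    have M1: "M1 p = a p *\<^sub>R N1 p + b p *\<^sub>R N2 p" and M2: "M2 p = c p *\<^sub>R N1 p + d p *\<^sub>R N2 p"
      if "p \<in> disc" for p
      using normal_plane_expansion[OF assms(1,2) that] M'[OF that]
      by (simp_all add: a_def b_def c_def d_def)
    have inner: "(x *\<^sub>R N1 p + y *\<^sub>R N2 p) \<bullet> (x' *\<^sub>R N1 p + y' *\<^sub>R N2 p) = x * x' + y * y'"
      if "p \<in> disc" for p x y x' y'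
      using inner_N[OF that] by (simp add: inner_add_left inner_add_right)
    have ab: "(a p)\<^sup>2 + (b p)\<^sup>2 = 1" and cd: "(c p)\<^sup>2 + (d p)\<^sup>2 = 1"
      and abcd: "a p * c p + b p * d p = 0" if "p \<in> disc" for p
      using M'(5-7)[OF that] inner[OF that] by (simp_all add: M1[OF that] M2[OF that] power2_eq_square)
    \<comment> \<open>Only the first row (a, b) is lifted to an angle, since it determines the
      second row up to sign. Writing 3 as \<open>Suc 2\<close> matches
      \<open>C_disc_angle\<close>.\<close>
    have "C_disc (Suc 2) M1" using M by (simp add: orthonormal_normal_section_def)
    then have "C_disc (Suc 2) a" "C_disc (Suc 2) b"
      unfolding a_def b_def using smooth by (auto intro!: C_disc_inner simp del: C_disc.simps)
    then obtain \<phi> where \<phi>: "C_disc (Suc 2) \<phi>" "\<And>p. p \<in> disc \<Longrightarrow> a p = cos (\<phi> p)"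
      "\<And>p. p \<in> disc \<Longrightarrow> b p = sin (\<phi> p)"
      using C_disc_angle[of 2 a b] ab by blast
    define M2' where "M2' = (\<lambda>p. - sin (\<phi> p) *\<^sub>R N1 p + cos (\<phi> p) *\<^sub>R N2 p)"
    \<comment> \<open>The sign may be chosen pointwise, as only squares of the torsion coefficients enter.\<close>
    have sign: "M2 p = M2' p \<or> M2 p = - M2' p" if "p \<in> disc" for p
      using unit_orthogonal_plane_cases[OF ab cd abcd, OF that that that] M2[OF that]
      by (auto simp: M2'_def \<phi>(2,3)[OF that])
    have "(torsion_u M1 M2 p)\<^sup>2 + (torsion_v M1 M2 p)\<^sup>2
        = (torsion_u M1 M2' p)\<^sup>2 + (torsion_v M1 M2' p)\<^sup>2" if "p \<in> disc" for p
      using sign[OF that] by (auto simp: torsion_u_def torsion_v_def)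
    then have "total_torsion M1 M2 = total_torsion M1 M2'"
      unfolding total_torsion_def by (intro arg_cong[where f = "\<lambda>x. 2 * x"] integral_cong)
    also have "\<dots> = total_torsion N1 N2 + 2 * dirichlet \<phi>"
      using \<phi> M1 by (intro tot) (simp_all add: M2'_def)
    finally show ?thesis using dirichlet_nonneg[of \<phi>] by simp
  qed
  \<comment> \<open>By \<open>tot\<close> the two torsions differ by twice the Dirichlet integral of
    \<open>\<phi>\<close>, so equality means that this integral is zero.\<close>
  moreover have "total_torsion N1 N2 = total_torsion M1 M2 \<longleftrightarrow> \<phi> constant_on disc"
    if "C_disc 3 \<phi>" "\<forall>p\<in>disc. M1 p = cos (\<phi> p) *\<^sub>R N1 p + sin (\<phi> p) *\<^sub>R N2 p \<and>
      M2 p = - sin (\<phi> p) *\<^sub>R N1 p + cos (\<phi> p) *\<^sub>R N2 p" for \<phi> M1 M2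
    using tot[of \<phi> M1 M2] that dirichlet_eq_0_iff[OF that(1)] by simp
  ultimately show ?thesis by blast
qed

end
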